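(* For any constant integer $d\ge 1$, there exist split graphs that do not have a $d$-dot product representation.
   Context: Graphs are finite and simple. A split graph is a graph whose vertices can be partitioned into two sets that induce an independent set and a clique. A $d$-dot product representation of a graph $G=(V,E)$ is an assignment of vectors $\mathbf{a}^u\in\mathbb{R}^d$ ($u\in V$) together with a threshold $t>0$ such that, for all distinct $u,v\in V$, $uv\in E$ if and only if $\mathbf{a}^u\cdot\mathbf{a}^v\ge t$ (one may take $t=1$ by scaling). *)

theory Defs
  imports "Graph_Theory.Pair_Digraph" "Jordan_Normal_Form.Matrix"
begin

text \<open>
  The locale predicate \<open>pair_graph G\<close> says that \<open>G\<close> is a finite simple graph: an undirected
  edge between \<open>u\<close> and \<open>v\<close> is the pair of arcs \<open>(u, v)\<close> and \<open>(v, u)\<close>.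
\<close>

definition independent_set :: "'a pair_pre_digraph \<Rightarrow> 'a set \<Rightarrow> bool" where
  "independent_set G I \<longleftrightarrow> I \<subseteq> pverts G \<and> (\<forall>u\<in>I. \<forall>v\<in>I. (u, v) \<notin> parcs G)"

definition clique :: "'a pair_pre_digraph \<Rightarrow> 'a set \<Rightarrow> bool" where
  "clique G K \<longleftrightarrow> K \<subseteq> pverts G \<and> (\<forall>u\<in>K. \<forall>v\<in>K. u \<noteq> v \<longrightarrow> (u, v) \<in> parcs G)"

text \<open>Either of the two parts may be empty.\<close>

definition split_graph :: "'a pair_pre_digraph \<Rightarrow> bool" where
  "split_graph G \<longleftrightarrow> pair_graph G \<and>
     (\<exists>I K. I \<union> K = pverts G \<and> I \<inter> K = {} \<and> independent_set G I \<and> clique G K)"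

definition dot_product_representation ::
    "nat \<Rightarrow> 'a pair_pre_digraph \<Rightarrow> ('a \<Rightarrow> real vec) \<Rightarrow> real \<Rightarrow> bool" where
  "dot_product_representation d G a t \<longleftrightarrow>
     t > 0 \<and> (\<forall>u\<in>pverts G. a u \<in> carrier_vec d) \<and>
     (\<forall>u\<in>pverts G. \<forall>v\<in>pverts G. u \<noteq> v \<longrightarrow>
        ((u, v) \<in> parcs G \<longleftrightarrow> scalar_prod (a u) (a v) \<ge> t))"

end

theory Submission
  imports Defs "Jordan_Normal_Form.Determinant" "HOL-Library.Nat_Bijection"
begin

text \<open>
  Half-spaces of \<open>\<real>\<^sup>d\<close> do not shatter \<open>d + 2\<close> points (Radon). In the split graph whose clique has
  \<open>d + 2\<close> vertices and whose independent part has one vertex for every subset of the clique, joined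
  to exactly that subset, a \<open>d\<close>-dot product representation would shatter the clique vectors by the
  half-spaces \<open>{x. x \<bullet> a v \<ge> t}\<close>.
\<close>

text \<open>The requirements on \<open>c\<close> amount to \<open>d + 1\<close> homogeneous linear
  equations, one per coordinate and one for the sum, in \<open>n > d + 1\<close> unknowns, so a
  nonzero solution exists.\<close>

lemma affine_dependence:
  fixes a :: "nat \<Rightarrow> real vec"
  assumes n: "d + 1 < n" and a: "\<And>i. i < n \<Longrightarrow> a i \<in> carrier_vec d"
  obtains c where "\<exists>i<n. c i \<noteq> 0" "(\<Sum>i<n. c i) = 0"
    "\<And>v. v \<in> carrier_vec d \<Longrightarrow> (\<Sum>i<n. c i * (a i \<bullet> v)) = 0"
proof -
  \<comment> \<open>Rows below \<open>d\<close> hold the coordinates of the \<open>a i\<close>, and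
    row \<open>d\<close> encodes that the coefficients sum to zero. Zero rows pad the matrix to a
    square so that a determinant is available; row \<open>d + 1\<close> is one of them.\<close>
  define A where
    "A = mat n n (\<lambda>(j, i). if j < d then a i $ j else if j = d then 1 else 0 :: real)"
  have A: "A \<in> carrier_mat n n" by (simp add: A_def)
  have "A = mat\<^sub>r n n (\<lambda>i. if i = d + 1 then 0\<^sub>v n else row A i)"
    by (rule eq_matI) (auto simp: A_def)
  moreover have "det (mat\<^sub>r n n (\<lambda>i. if i = d + 1 then 0\<^sub>v n else row A i)) = 0"
    using n A by (intro det_row_0) auto
  ultimately have "det A = 0" by simp
  then obtain x where x: "x \<in> carrier_vec n" "x \<noteq> 0\<^sub>v n" "A *\<^sub>v x = 0\<^sub>v n"
    using det_0_iff_vec_prod_zero[OF A] by blast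
  have eq: "(\<Sum>i<n. A $$ (j, i) * x $ i) = 0" if "j < n" for j
  proof -
    have "(A *\<^sub>v x) $ j = 0" using x that by simp
    then show ?thesis
      using that A x(1) by (simp add: scalar_prod_def atLeast0LessThan)
  qed
  show thesis
  proof
    show "\<exists>i<n. x $ i \<noteq> 0"
      using x(1,2) by (metis eq_vecI carrier_vecD index_zero_vec)
    show "(\<Sum>i<n. x $ i) = 0"
      using eq[of d] n by (simp add: A_def)
    fix v :: "real vec" assume v: "v \<in> carrier_vec d"
    \<comment> \<open>After exchanging the sums, the claim is the combination of the first
      \<open>d\<close> kernel equations with weights \<open>v $ j\<close>.\<close>
    have "x $ i * (a i \<bullet> v) = (\<Sum>j<d. v $ j * (A $$ (j, i) * x $ i))" if "i < n" for i
    proof -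
      have "a i \<bullet> v = (\<Sum>j<d. a i $ j * v $ j)"
        using v by (simp add: scalar_prod_def atLeast0LessThan)
      then have "x $ i * (a i \<bullet> v) = (\<Sum>j<d. x $ i * (a i $ j * v $ j))"
        by (simp add: sum_distrib_left)
      also have "\<dots> = (\<Sum>j<d. v $ j * (A $$ (j, i) * x $ i))"
        using that n by (intro sum.cong) (auto simp: A_def)
      finally show ?thesis .
    qed
    then have "(\<Sum>i<n. x $ i * (a i \<bullet> v)) = (\<Sum>i<n. \<Sum>j<d. v $ j * (A $$ (j, i) * x $ i))"
      by simp
    also have "\<dots> = (\<Sum>j<d. v $ j * (\<Sum>i<n. A $$ (j, i) * x $ i))"
      by (subst sum.swap) (simp add: sum_distrib_left)
    also have "\<dots> = 0" using eq n by simp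
    finally show "(\<Sum>i<n. x $ i * (a i \<bullet> v)) = 0" .
  qed
qed

text \<open>Take for \<open>P\<close> the indices with positive coefficient in an affine dependence
  \<open>c\<close>. If a half-space cut out exactly \<open>P\<close>, the sum of
  \<open>c i * (a i \<bullet> v - t)\<close> would be positive, whereas the dependence makes it
  zero.\<close>

lemma half_spaces_not_shattering:
  fixes a :: "nat \<Rightarrow> real vec"
  assumes n: "d + 1 < n" and a: "\<And>i. i < n \<Longrightarrow> a i \<in> carrier_vec d"
  obtains P where "P \<subseteq> {..<n}"
    "\<And>v t. v \<in> carrier_vec d \<Longrightarrow> \<not> (\<forall>i<n. i \<in> P \<longleftrightarrow> a i \<bullet> v \<ge> t)"
proof -
  obtain c where c: "\<exists>i<n. c i \<noteq> 0" "(\<Sum>i<n. c i) = 0"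
    "\<And>v. v \<in> carrier_vec d \<Longrightarrow> (\<Sum>i<n. c i * (a i \<bullet> v)) = 0"
    using affine_dependence[of d n a] n a by blast
  \<comment> \<open>A negative coefficient supplies the strict inequality: points outside
    \<open>P\<close> satisfy \<open>a i \<bullet> v < t\<close>, while points of \<open>P\<close>
    may lie on the hyperplane and contribute zero.\<close>
  have "\<exists>i<n. c i < 0"
  proof (rule ccontr)
    assume "\<not> (\<exists>i<n. c i < 0)"
    then have "\<forall>i\<in>{..<n}. 0 \<le> c i" by (meson lessThan_iff not_less)
    then have "\<forall>i\<in>{..<n}. c i = 0"
      using c(2) sum_nonneg_eq_0_iff[of "{..<n}" c] by simp
    with c(1) show False by auto
  qed
  then obtain k where k: "k < n" "c k < 0" by blast
  show thesis
  proof (rule that[of "{i. i < n \<and> c i > 0}"])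
    fix v :: "real vec" and t
    assume v: "v \<in> carrier_vec d"
    show "\<not> (\<forall>i<n. i \<in> {i. i < n \<and> c i > 0} \<longleftrightarrow> a i \<bullet> v \<ge> t)"
    proof
      assume "\<forall>i<n. i \<in> {i. i < n \<and> c i > 0} \<longleftrightarrow> a i \<bullet> v \<ge> t"
      then have sep: "c i > 0 \<longleftrightarrow> a i \<bullet> v \<ge> t" if "i < n" for i
        using that by simp
      have "0 < (\<Sum>i<n. c i * (a i \<bullet> v - t))"
      proof (rule sum_pos2[of _ k])
        show "0 < c k * (a k \<bullet> v - t)"
          using k sep[of k] by (intro mult_neg_neg) auto
        show "0 \<le> c i * (a i \<bullet> v - t)" if "i \<in> {..<n}" for i
          using that sep[of i] by (cases "c i > 0") (auto simp: zero_le_mult_iff)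
      qed (use k in auto)
      also have "\<dots> = (\<Sum>i<n. c i * (a i \<bullet> v)) - (\<Sum>i<n. c i) * t"
        by (simp add: right_diff_distrib sum_subtractf sum_distrib_right)
      finally show False using c(2) c(3)[OF v] by simp
    qed
  qed auto
qed

text \<open>Vertex \<open>n + k\<close> is joined to the clique vertices in the set with binary code \<open>k\<close>.\<close>

definition subset_adj :: "nat \<Rightarrow> nat \<Rightarrow> nat \<Rightarrow> bool" where
  "subset_adj n u v \<longleftrightarrow> u < n \<and> (v < n \<or> u \<in> set_decode (v - n))"

text \<open>The first argument of \<open>subset_adj\<close> is always a clique vertex, so the
  disjunction makes the arcs symmetric. The codes below \<open>2 ^ n\<close> are exactly those of
  the subsets of \<open>{..<n}\<close>.\<close>

definition subset_split_graph :: "nat \<Rightarrow> nat pair_pre_digraph" where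
  "subset_split_graph n = \<lparr>pverts = {..<n + 2 ^ n},
     parcs = {(u, v). u < n + 2 ^ n \<and> v < n + 2 ^ n \<and> u \<noteq> v \<and>
       (subset_adj n u v \<or> subset_adj n v u)}\<rparr>"

lemma split_graph_subset_split_graph: "split_graph (subset_split_graph n)"
proof -
  let ?G = "subset_split_graph n"
  have "finite (parcs ?G)"
    by (rule finite_subset[of _ "{..<n + 2 ^ n} \<times> {..<n + 2 ^ n}"])
      (auto simp: subset_split_graph_def)
  then have "pair_graph ?G"
    by unfold_locales (auto simp: subset_split_graph_def symmetric_def intro!: symI)
  moreover have "independent_set ?G {n..<n + 2 ^ n}" "clique ?G {..<n}"
    by (auto simp: independent_set_def clique_def subset_split_graph_def subset_adj_def)
  moreover have "{n..<n + 2 ^ n} \<union> {..<n} = pverts ?G" "{n..<n + 2 ^ n} \<inter> {..<n} = {}"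
    by (auto simp: subset_split_graph_def)
  ultimately show ?thesis unfolding split_graph_def by blast
qed

text \<open>Ensures that the vertex \<open>n + set_encode P\<close> belongs to the graph: the code
  is a sum of distinct powers of two with exponents below \<open>n\<close>.\<close>

lemma set_encode_less_power:
  assumes "P \<subseteq> {..<n}"
  shows "set_encode P < 2 ^ n"
proof -
  have "set_encode P \<le> (\<Sum>i<n. 2 ^ i)"
    unfolding set_encode_def using assms by (intro sum_mono2) auto
  also have "\<dots> < 2 ^ n"
    by (induction n) auto
  finally show ?thesis .
qed

lemma subset_split_graph_not_representable:
  assumes n: "d + 1 < n"
  shows "\<not> dot_product_representation d (subset_split_graph n) a t"
proof
  assume rep: "dot_product_representation d (subset_split_graph n) a t"
  have carrier: "a u \<in> carrier_vec d" if "u < n + 2 ^ n" for u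
    using rep that by (auto simp: dot_product_representation_def subset_split_graph_def)
  then have "\<And>i. i < n \<Longrightarrow> a i \<in> carrier_vec d"
    by (meson trans_less_add1)
  then obtain P where P: "P \<subseteq> {..<n}"
    "\<And>v t. v \<in> carrier_vec d \<Longrightarrow> \<not> (\<forall>i<n. i \<in> P \<longleftrightarrow> a i \<bullet> v \<ge> t)"
    using half_spaces_not_shattering[OF n] by blast
  \<comment> \<open>This is the independent vertex whose neighbourhood is \<open>P\<close>; its
    vector would be the normal of a half-space that cuts out \<open>P\<close>.\<close>
  define v where "v = n + set_encode P"
  have v: "v < n + 2 ^ n" "\<not> v < n"
    using set_encode_less_power[OF P(1)] by (simp_all add: v_def)
  have decode: "set_decode (v - n) = P"
    using finite_subset[OF P(1)] by (simp add: v_def)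
  have "i \<in> P \<longleftrightarrow> a i \<bullet> a v \<ge> t" if i: "i < n" for i
  proof -
    have "(i, v) \<in> parcs (subset_split_graph n) \<longleftrightarrow> i \<in> P"
      using i v decode by (auto simp: subset_split_graph_def subset_adj_def)
    moreover have "(i, v) \<in> parcs (subset_split_graph n) \<longleftrightarrow> a i \<bullet> a v \<ge> t"
      using rep i v unfolding dot_product_representation_def
      by (auto simp: subset_split_graph_def)
    ultimately show ?thesis by simp
  qed
  with P(2)[OF carrier[OF v(1)]] show False by blast
qed

theorem mainTheorem9:
  fixes d :: nat
  assumes "d \<ge> 1"
  shows "\<exists>G :: nat pair_pre_digraph.
           split_graph G \<and> \<not> (\<exists>a t. dot_product_representation d G a t)"
  using split_graph_subset_split_graph[of "d + 2"] subset_split_graph_not_representable[of d "d + 2"]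
  by auto

end
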